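(* Let $N\ge 2$ and let $H(\theta)$, $\theta=\ln q$ with $q\in(0,1)$, be a family of symmetric $D_N$-equivariant matrices on $\mathbb{R}^N$ of the form $$H(\theta)=C_0+\sum_{s\in\mathcal S}e^{s\theta}C_s,\qquad C_s\succeq 0,\quad C_s\ D_N\text{-equivariant},\qquad H_{OO}(\theta)\succ 0,$$ with block decomposition relative to $\mathbb{R}^N=B\oplus O$. Then the Schur curvature $$\kappa_{\mathrm{Schur}}(\theta)=\frac{1}{\dim B}\operatorname{Tr}\Big(H_{BB}(\theta)-H_{BO}(\theta)H_{OO}(\theta)^{-1}H_{OB}(\theta)\Big)$$ is a convex function of the logarithmic parameter $\theta=\ln q$ for $q\in(0,1)$.
   Context: $D_N$ is the dihedral group acting on $\mathbb{R}^N$ by permuting coordinates as the symmetries of a regular $N$-gon; a matrix is $D_N$-equivariant if it commutes with this action. Fix a metric (the "projector metric") with radius parameter $m_\rho^2>0$ inducing an orthogonal decomposition $B\oplus O$, where $O=\mathrm{span}\{\mathbf 1\}$, $\mathbf 1=(1,\dots,1)$, is the collective mode and $B=\{v\in\mathbb{R}^N:\sum_r v_r=0\}$ is its orthogonal complement (the band sector). With respect to $B\oplus O$, $$H(\theta)=\begin{bmatrix}H_{BB}(\theta)&H_{BO}(\theta)\\ H_{OB}(\theta)&H_{OO}(\theta)\end{bmatrix}.$$ $\mathcal S$ is an index set of real exponents over which the sum makes sense, and $\succeq,\succ$ denote the Loewner order. *)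

theory Defs
  imports "HOL-Analysis.Analysis" "Berlekamp_Zassenhaus.Finite_Field"
begin

text \<open>
  Coordinates of \<open>\<real>^N\<close> are indexed by \<open>\<int>/N\<close>, i.e. by the type \<open>'n mod_ring\<close> with
  \<open>N = CARD('n)\<close>; its elements label the vertices of the regular \<open>N\<close>-gon in cyclic order.
\<close>

definition dihedral :: "('n::finite mod_ring \<Rightarrow> 'n mod_ring) set" where
  "dihedral = range (\<lambda>a i. a + i) \<union> range (\<lambda>a i. a - i)"

definition permute_coords :: "('i::finite \<Rightarrow> 'i) \<Rightarrow> real ^ 'i \<Rightarrow> real ^ 'i" where
  "permute_coords \<pi> v = (\<chi> i. v $ inv_into UNIV \<pi> i)"

definition dihedral_equivariant :: "real ^ 'n mod_ring ^ 'n::finite mod_ring \<Rightarrow> bool" where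
  "dihedral_equivariant M \<longleftrightarrow>
     (\<forall>\<pi>\<in>dihedral. \<forall>v. M *v permute_coords \<pi> v = permute_coords \<pi> (M *v v))"

text \<open>
  Comparison with \<open>0\<close> in the Loewner order for the symmetric operator that \<open>A\<close> induces on a
  subspace \<open>U\<close> (with \<open>U = UNIV\<close> for the full space).
\<close>

definition loewner_nonneg_on :: "(real ^ 'i) set \<Rightarrow> real ^ 'i ^ 'i::finite \<Rightarrow> bool" where
  "loewner_nonneg_on U A \<longleftrightarrow>
     (\<forall>u\<in>U. \<forall>v\<in>U. u \<bullet> (A *v v) = (A *v u) \<bullet> v) \<and> (\<forall>v\<in>U. 0 \<le> v \<bullet> (A *v v))"

definition loewner_pos_on :: "(real ^ 'i) set \<Rightarrow> real ^ 'i ^ 'i::finite \<Rightarrow> bool" where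
  "loewner_pos_on U A \<longleftrightarrow>
     (\<forall>u\<in>U. \<forall>v\<in>U. u \<bullet> (A *v v) = (A *v u) \<bullet> v) \<and> (\<forall>v\<in>U. v \<noteq> 0 \<longrightarrow> 0 < v \<bullet> (A *v v))"

definition collective :: "(real ^ 'i::finite) set" where
  "collective = span {1}"

definition band :: "(real ^ 'i::finite) set" where
  "band = {v. (\<Sum>i\<in>UNIV. v $ i) = 0}"

text \<open>
  An inner product \<open>g\<close> that makes the band sector and the collective mode orthogonal.  The radius
  parameter is its weight on the collective mode relative to the Euclidean inner product;
  no particular form of \<open>g\<close> on the band sector is prescribed.  The basic example is
  \<open>g u v = (P\<^sub>B u) \<bullet> (P\<^sub>B v) + m\<rho>2 * ((P\<^sub>O u) \<bullet> (P\<^sub>O v))\<close> with the Euclidean projections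
  onto the two sectors.
\<close>

definition projector_metric ::
    "real \<Rightarrow> (real ^ 'i \<Rightarrow> real ^ 'i::finite \<Rightarrow> real) \<Rightarrow> bool" where
  "projector_metric m\<rho>2 g \<longleftrightarrow>
     bilinear g \<and> (\<forall>u v. g u v = g v u) \<and> (\<forall>v. v \<noteq> 0 \<longrightarrow> 0 < g v v) \<and>
     (\<forall>b\<in>band. \<forall>c\<in>collective. g b c = 0) \<and>
     (\<forall>c\<in>collective. \<forall>d\<in>collective. g c d = m\<rho>2 * (c \<bullet> d))"

definition metric_proj ::
    "(real ^ 'i \<Rightarrow> real ^ 'i \<Rightarrow> real) \<Rightarrow> (real ^ 'i) set \<Rightarrow> real ^ 'i ^ 'i::finite" where
  "metric_proj g U = matrix (\<lambda>v. THE u. u \<in> U \<and> (\<forall>w\<in>U. g (v - u) w = 0))"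

text \<open>
  The block \<open>H\<^sub>X\<^sub>Y : Y \<rightarrow> X\<close> is represented by the matrix of its extension by zero on the orthogonal
  complement of \<open>Y\<close>.  Products of blocks are then matrix products, and the trace of
  a diagonal block, as an operator on its sector, is the trace of the representing matrix.
\<close>

definition block ::
    "(real ^ 'i \<Rightarrow> real ^ 'i \<Rightarrow> real) \<Rightarrow> (real ^ 'i) set \<Rightarrow> (real ^ 'i) set \<Rightarrow>
     real ^ 'i ^ 'i \<Rightarrow> real ^ 'i ^ 'i::finite" where
  "block g X Y H = metric_proj g X ** H ** metric_proj g Y"

text \<open>
  The inverse of a diagonal block as an operator on its sector \<open>X\<close>, in the same
  representation: the identity of \<open>X\<close> is represented by the projection onto \<open>X\<close>.
\<close>

definition block_inverse ::
    "(real ^ 'i \<Rightarrow> real ^ 'i \<Rightarrow> real) \<Rightarrow> (real ^ 'i) set \<Rightarrow>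
     real ^ 'i ^ 'i \<Rightarrow> real ^ 'i ^ 'i::finite" where
  "block_inverse g X A =
     (THE K. block g X X K = K \<and> A ** K = metric_proj g X \<and> K ** A = metric_proj g X)"

definition schur_complement ::
    "(real ^ 'i \<Rightarrow> real ^ 'i \<Rightarrow> real) \<Rightarrow> real ^ 'i ^ 'i \<Rightarrow> real ^ 'i ^ 'i::finite" where
  "schur_complement g H =
     block g band band H -
     block g band collective H **
       block_inverse g collective (block g collective collective H) **
       block g collective band H"

definition schur_curvature ::
    "(real ^ 'i \<Rightarrow> real ^ 'i \<Rightarrow> real) \<Rightarrow> real ^ 'i ^ 'i::finite \<Rightarrow> real" where
  "schur_curvature g H =
     1 / real (dim (band :: (real ^ 'i) set)) * trace (schur_complement g H)"

end

theory Submission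
  imports Defs
begin

text \<open>
  A cyclically equivariant matrix maps \<open>\<one> = (1,\<dots>,1)\<close> to a rotation-invariant vector, i.e. to a
  multiple of \<open>\<one>\<close>.  Since every projector metric has the same projections onto the two sectors as
  the Euclidean inner product, the block \<open>H\<^sub>B\<^sub>O\<close> vanishes and the Schur complement is just \<open>H\<^sub>B\<^sub>B\<close>.
  Its trace is linear in \<open>H\<close>, so it is a constant plus a sum of exponentials \<open>e\<^bsup>s\<theta>\<^esup>\<close> with
  weights \<open>Tr (C\<^sub>s)\<^sub>B\<^sub>B \<ge> 0\<close>.
\<close>

text \<open>This is the Euclidean orthogonal projection onto the line spanned by
  \<open>1\<close>.\<close>

definition mean_part :: "real ^ 'i \<Rightarrow> real ^ 'i::finite" where
  "mean_part v = ((\<Sum>i\<in>UNIV. v $ i) / real CARD('i)) *\<^sub>R 1"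

lemma linear_mean_part: "linear (mean_part :: real ^ 'i \<Rightarrow> real ^ 'i::finite)"
  by (rule linearI)
    (simp_all add: mean_part_def vec_eq_iff sum.distrib add_divide_distrib flip: sum_distrib_left)

lemma mean_part_in_collective: "mean_part v \<in> collective"
  unfolding mean_part_def collective_def by (simp add: span_base span_scale)

lemma mean_part_one: "mean_part 1 = (1 :: real ^ 'i::finite)"
  by (simp add: mean_part_def)

lemma diff_mean_part_in_band: "v - mean_part v \<in> band"
  by (simp add: band_def mean_part_def sum_subtractf)

lemma inner_mean_part: "mean_part v \<bullet> w = v \<bullet> mean_part w"
  by (simp add: mean_part_def inner_vec_def flip: sum_distrib_left sum_distrib_right sum_divide_distrib)

lemma subspace_band: "subspace band"
  by (auto simp: subspace_def band_def sum.distrib simp flip: sum_distrib_left)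

text \<open>Positive definiteness of \<open>g\<close> makes the orthogonal projection unique, so the
  definite description in \<open>metric_proj\<close> can be evaluated by exhibiting any map with the
  right properties. Linearity of \<open>f\<close> lets \<open>matrix f\<close> reproduce it.\<close>

lemma metric_proj_works:
  assumes "bilinear g" and pos: "\<And>v. v \<noteq> 0 \<Longrightarrow> 0 < g v v" and U: "subspace U"
    and f: "linear f" "\<And>v. f v \<in> U" "\<And>v w. w \<in> U \<Longrightarrow> g (v - f v) w = 0"
  shows "metric_proj g U *v v = f v"
proof -
  have "(THE u. u \<in> U \<and> (\<forall>w\<in>U. g (v - u) w = 0)) = f v" for v
  proof (rule the_equality)
    show "f v \<in> U \<and> (\<forall>w\<in>U. g (v - f v) w = 0)"
      using f by blast
  next
    fix u assume u: "u \<in> U \<and> (\<forall>w\<in>U. g (v - u) w = 0)"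
    have d: "f v - u \<in> U"
      using u f(2) U by (simp add: subspace_diff)
    \<comment> \<open>Both residuals \<open>v - u\<close> and \<open>v - f v\<close> are orthogonal
      to \<open>f v - u\<close>, which lies in \<open>U\<close>.\<close>
    have "g (f v - u) (f v - u) = g ((v - u) - (v - f v)) (f v - u)"
      by simp
    also have "\<dots> = g (v - u) (f v - u) - g (v - f v) (f v - u)"
      by (rule bilinear_lsub[OF \<open>bilinear g\<close>])
    also have "\<dots> = 0"
      using u d by (simp only: f(3) diff_self)
    finally show "u = f v"
      using pos[of "f v - u"] by force
  qed
  then have "metric_proj g U = matrix f"
    by (simp add: metric_proj_def)
  then show ?thesis
    using f(1) by (simp add: matrix_works)
qed

lemma metric_proj_collective:
  assumes "projector_metric m g"
  shows "metric_proj g collective *v v = mean_part v"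
proof (rule metric_proj_works)
  show "subspace collective"
    by (simp add: collective_def)
  show "g (v - mean_part v) w = 0" if "w \<in> collective" for v w
    using assms that diff_mean_part_in_band[of v] unfolding projector_metric_def by blast
qed (use assms in
    \<open>auto simp: projector_metric_def linear_mean_part mean_part_in_collective\<close>)

lemma metric_proj_band:
  assumes "projector_metric m g"
  shows "metric_proj g band *v v = v - mean_part v"
proof (rule metric_proj_works)
  show "linear (\<lambda>v. v - mean_part v)"
    by (simp add: linear_compose_sub linear_mean_part linear_ident)
  \<comment> \<open>The residual is \<open>mean_part v\<close>; symmetry of \<open>g\<close> moves
    it to the second argument, where the orthogonality of the two sectors applies.\<close>
  show "g (v - (v - mean_part v)) w = 0" if "w \<in> band" for v w
    using assms that mean_part_in_collective[of v] by (simp add: projector_metric_def)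
qed (use assms in \<open>auto simp: projector_metric_def subspace_band diff_mean_part_in_band\<close>)

lemma dihedral_equivariant_one:
  fixes M :: "real ^ 'n mod_ring ^ 'n::finite mod_ring"
  assumes "dihedral_equivariant M"
  obtains c where "M *v 1 = c *\<^sub>R 1"
proof
  show "M *v 1 = ((M *v 1) $ 0) *\<^sub>R 1"
  proof (simp add: vec_eq_iff, rule allI)
    fix a :: "'n mod_ring"
    \<comment> \<open>The rotation taking vertex 0 to vertex \<open>a\<close> fixes
      \<open>1\<close>, hence also \<open>M *v 1\<close>, so the entries at 0 and \<open>a\<close>
      agree.\<close>
    let ?\<pi> = "\<lambda>i. a + i"
    have "inv_into UNIV ?\<pi> (?\<pi> 0) = 0"
      by (rule inv_f_f) (simp add: inj_def)
    then have "permute_coords ?\<pi> w $ a = w $ 0" for w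
      by (simp add: permute_coords_def)
    moreover have "permute_coords ?\<pi> 1 = 1"
      by (simp add: permute_coords_def vec_eq_iff)
    moreover have "M *v permute_coords ?\<pi> 1 = permute_coords ?\<pi> (M *v 1)"
      using assms by (auto simp: dihedral_equivariant_def dihedral_def)
    ultimately show "(M *v 1) $ a = (M *v 1) $ 0"
      by metis
  qed
qed

lemma schur_complement_equivariant:
  assumes g: "projector_metric m g" and "dihedral_equivariant M"
  shows "schur_complement g M = block g band band M"
proof -
  obtain c where c: "M *v 1 = c *\<^sub>R 1"
    using dihedral_equivariant_one assms(2) .
  \<comment> \<open>The collective projection of \<open>v\<close> is a multiple of \<open>1\<close>,
    \<open>M\<close> keeps it on that line, and the band projection annihilates the line.\<close>
  have "block g band collective M *v v = 0" for v
    by (simp add: c mean_part_one block_def metric_proj_band[OF g] metric_proj_collective[OF g]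
        mean_part_def[of v] matrix_vector_mult_scaleR flip: matrix_vector_mul_assoc)
  then have "block g band collective M = 0"
    by (simp add: matrix_eq)
  then show ?thesis
    by (simp add: schur_complement_def)
qed

text \<open>The band projection \<open>?Q\<close> is symmetric by \<open>inner_mean_part\<close>.
  The diagonal entries of \<open>?Q M ?Q\<close> are therefore values of the quadratic form of
  \<open>M\<close> at the vectors \<open>?Q (axis i 1)\<close>.\<close>

lemma trace_block_band_nonneg:
  fixes M :: "real ^ 'i ^ 'i::finite"
  assumes g: "projector_metric m g" and "loewner_nonneg_on UNIV M"
  shows "0 \<le> trace (block g band band M)"
proof -
  let ?Q = "\<lambda>v :: real ^ 'i. v - mean_part v"
  have "trace (block g band band M) = (\<Sum>i\<in>UNIV. axis i 1 \<bullet> (block g band band M *v axis i 1))"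
    by (simp add: trace_def inner_axis' matrix_vector_mult_basis column_def)
  also have "\<dots> = (\<Sum>i\<in>UNIV. ?Q (axis i 1) \<bullet> (M *v ?Q (axis i 1)))"
    by (simp add: block_def metric_proj_band[OF g] inner_diff_left inner_diff_right inner_mean_part
        flip: matrix_vector_mul_assoc)
  also have "\<dots> \<ge> 0"
    using assms(2) unfolding loewner_nonneg_on_def by (intro sum_nonneg) blast
  finally show ?thesis .
qed

lemma matrix_add_rdistrib:
  fixes A B :: "'a::semiring_1 ^ 'n ^ 'm"
  shows "(A + B) ** C = A ** C + B ** C"
  by (simp add: matrix_matrix_mult_def vec_eq_iff distrib_right sum.distrib)

text \<open>Linear maps in finite dimension are bounded; boundedness is what carries the trace
  through the infinite sum over exponents.\<close>

lemma bounded_linear_trace_block: "bounded_linear (\<lambda>M. trace (block g X Y M))"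
  unfolding linear_conv_bounded_linear[symmetric]
  by (rule linearI)
    (simp_all add: block_def matrix_add_ldistrib matrix_add_rdistrib
      matrix_scalar_ac trace_def sum.distrib sum_distrib_left flip: scalar_matrix_assoc)

lemma convex_on_eq:
  assumes "convex_on A f" and "\<And>x. x \<in> A \<Longrightarrow> g x = f x"
  shows "convex_on A g"
  using assms by (simp add: convex_on_def convex_def)

text \<open>The convexity inequalities of the terms are summed; summability at the endpoints splits
  the upper bound, and at \<open>?z\<close> it permits the comparison.\<close>

lemma convex_on_infsum:
  fixes f :: "'a \<Rightarrow> 'b::real_vector \<Rightarrow> real"
  assumes "convex A" and cvx: "\<And>s. s \<in> S \<Longrightarrow> convex_on A (f s)"
    and sm: "\<And>x. x \<in> A \<Longrightarrow> (\<lambda>s. f s x) summable_on S"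
  shows "convex_on A (\<lambda>x. \<Sum>\<^sub>\<infinity>s\<in>S. f s x)"
proof (rule convex_onI)
  fix t x y assume t: "0 < t" "t < (1::real)" and x: "x \<in> A" and y: "y \<in> A"
  let ?z = "(1 - t) *\<^sub>R x + t *\<^sub>R y"
  have z: "?z \<in> A"
    using convexD_alt[OF \<open>convex A\<close> x y] t by simp
  have s: "(\<lambda>s. (1 - t) * f s x) summable_on S" "(\<lambda>s. t * f s y) summable_on S"
    using sm x y by (auto intro: summable_on_cmult_right)
  have "(\<Sum>\<^sub>\<infinity>s\<in>S. f s ?z) \<le> (\<Sum>\<^sub>\<infinity>s\<in>S. (1 - t) * f s x + t * f s y)"
    using t x y by (intro infsum_mono sm z summable_on_add s convex_onD[OF cvx]) auto
  also have "\<dots> = (1 - t) * (\<Sum>\<^sub>\<infinity>s\<in>S. f s x) + t * (\<Sum>\<^sub>\<infinity>s\<in>S. f s y)"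
    using s sm x y by (simp add: infsum_add infsum_cmult_right)
  finally show "(\<Sum>\<^sub>\<infinity>s\<in>S. f s ?z) \<le> (1 - t) * (\<Sum>\<^sub>\<infinity>s\<in>S. f s x) + t * (\<Sum>\<^sub>\<infinity>s\<in>S. f s y)" .
qed (fact assms(1))

text \<open>The second derivative \<open>s * (s * exp (s * x))\<close> is nonnegative for either
  sign of \<open>s\<close>.\<close>

lemma convex_on_exp_mult: "convex A \<Longrightarrow> convex_on A (\<lambda>x::real. exp (s * x))"
  by (rule f''_ge0_imp_convex[of _ _ "\<lambda>x. s * exp (s * x)" "\<lambda>x. s * (s * exp (s * x))"])
    (auto intro!: derivative_eq_intros simp flip: mult.assoc)

theorem theorem3p1:
  fixes H :: "real \<Rightarrow> real ^ 'n::finite mod_ring ^ 'n mod_ring"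
    and C0 :: "real ^ 'n mod_ring ^ 'n mod_ring"
    and C :: "real \<Rightarrow> real ^ 'n mod_ring ^ 'n mod_ring"
    and S :: "real set"
    and g :: "real ^ 'n mod_ring \<Rightarrow> real ^ 'n mod_ring \<Rightarrow> real"
    and m\<rho>2 :: real
  assumes "CARD('n) \<ge> 2"
    and "m\<rho>2 > 0"
    and "projector_metric m\<rho>2 g"
    and "\<And>\<theta>. \<theta> \<in> ln ` {0<..<1} \<Longrightarrow> transpose (H \<theta>) = H \<theta>"
    and "\<And>\<theta>. \<theta> \<in> ln ` {0<..<1} \<Longrightarrow> dihedral_equivariant (H \<theta>)"
    and "\<And>\<theta>. \<theta> \<in> ln ` {0<..<1} \<Longrightarrow> (\<lambda>s. exp (s * \<theta>) *\<^sub>R C s) summable_on S"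
    and "\<And>\<theta>. \<theta> \<in> ln ` {0<..<1} \<Longrightarrow> H \<theta> = C0 + (\<Sum>\<^sub>\<infinity>s\<in>S. exp (s * \<theta>) *\<^sub>R C s)"
    and "\<And>s. s \<in> S \<Longrightarrow> loewner_nonneg_on UNIV (C s)"
    and "\<And>s. s \<in> S \<Longrightarrow> dihedral_equivariant (C s)"
    and "\<And>\<theta>. \<theta> \<in> ln ` {0<..<1} \<Longrightarrow>
           loewner_pos_on collective (block g collective collective (H \<theta>))"
  shows "convex_on (ln ` {0<..<1}) (\<lambda>\<theta>. schur_curvature g (H \<theta>))"
proof -
  let ?A = "ln ` {0<..<1::real}"
  let ?T = "\<lambda>M. trace (block g band band M)"
  let ?d = "1 / real (dim (band :: (real ^ 'n mod_ring) set))"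
  \<comment> \<open>Each negative \<theta> is the logarithm of \<open>exp\<close> \<theta>, which
    lies in the open unit interval.\<close>
  have "?A = {..<0}"
  proof
    show "{..<0} \<subseteq> ?A"
      by (auto intro!: rev_image_eqI[where x = "exp _"])
  qed auto
  then have A: "convex ?A"
    by simp
  have bl: "bounded_linear ?T"
    by (rule bounded_linear_trace_block)
  interpret T: bounded_linear ?T
    by (fact bl)
  have sm: "(\<lambda>s. exp (s * \<theta>) * ?T (C s)) summable_on S" if "\<theta> \<in> ?A" for \<theta>
    using summable_on_bounded_linear[OF bl assms(6)[OF that]]
    by (simp add: T.scaleR)
  have eq: "schur_curvature g (H \<theta>) = ?d * (?T C0 + (\<Sum>\<^sub>\<infinity>s\<in>S. exp (s * \<theta>) * ?T (C s)))"
    if "\<theta> \<in> ?A" for \<theta>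
  proof -
    have "?T (H \<theta>) = ?T C0 + (\<Sum>\<^sub>\<infinity>s\<in>S. ?T (exp (s * \<theta>) *\<^sub>R C s))"
      using infsumI[OF has_sum_bounded_linear[OF bl has_sum_infsum[OF assms(6)[OF that]]]]
      by (simp add: assms(7)[OF that] T.add)
    then show ?thesis
      by (simp add: schur_curvature_def T.scaleR
          schur_complement_equivariant[OF assms(3) assms(5)[OF that]])
  qed
  have "convex_on ?A (\<lambda>\<theta>. \<Sum>\<^sub>\<infinity>s\<in>S. exp (s * \<theta>) * ?T (C s))"
  proof (rule convex_on_infsum[OF A _ sm])
    show "convex_on ?A (\<lambda>\<theta>. exp (s * \<theta>) * ?T (C s))" if "s \<in> S" for s
      using convex_on_cmul[OF _ convex_on_exp_mult[OF A]]
        trace_block_band_nonneg[OF assms(3) assms(8)[OF that]]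
      by (simp add: mult.commute[of _ "?T (C s)"])
  qed
  then have "convex_on ?A (\<lambda>\<theta>. ?d * (?T C0 + (\<Sum>\<^sub>\<infinity>s\<in>S. exp (s * \<theta>) * ?T (C s))))"
    using A by (intro convex_on_cmul convex_on_add) (auto simp: convex_on_const)
  then show ?thesis
    by (rule convex_on_eq) (rule eq)
qed

end
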